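(* For $n\ge 1$ let $\mathcal{A}(n,2)\in\mathbb{R}^{n\times n}$ be the $n$-dimensional Moler matrix, i.e. $\mathcal{A}(n,2)_{i,i}=i$ and $\mathcal{A}(n,2)_{i,j}=\min\{i,j\}-2$ for $i\ne j$. Then: (1) $\mathcal{A}(n,2)$ is positive definite; (2) if $\lambda_{\min}(\mathcal{A}(n,2))$ denotes the smallest eigenvalue of $\mathcal{A}(n,2)$, then $\lambda_{\min}(\mathcal{A}(n,2))\searrow 0$ as $n\to\infty$, i.e. the sequence $\lambda_{\min}(\mathcal{A}(n,2))$ is non-increasing in $n$ and converges to $0$. *)

theory Defs
  imports "Jordan_Normal_Form.Spectral_Radius"
begin

(* Matrix indices start at 0, so the entry at (i, j) is the one at (i + 1, j + 1) in the usual
   1-based convention; the subtraction of 2 takes place in the reals. *)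
definition moler_mat :: "nat \<Rightarrow> real mat" where
  "moler_mat n = mat n n (\<lambda>(i, j).
     if i = j then real (i + 1) else real (min (i + 1) (j + 1)) - 2)"

definition positive_definite :: "real mat \<Rightarrow> bool" where
  "positive_definite A \<longleftrightarrow>
     square_mat A \<and> transpose_mat A = A \<and>
     (\<forall>v \<in> carrier_vec (dim_row A). v \<noteq> 0\<^sub>v (dim_row A) \<longrightarrow> v \<bullet> (A *\<^sub>v v) > 0)"

(* The spectrum of a real matrix is here its set of real eigenvalues. For a symmetric matrix of
   dimension at least 1 these are all its eigenvalues, and the set is finite and nonempty. *)
definition lambda_min :: "real mat \<Rightarrow> real" where
  "lambda_min A = Min (spectrum A)"

end

theory Submission
  imports Defs "HOL-Analysis.L2_Norm" "HOL-Real_Asymp.Real_Asymp"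
begin

text \<open>The Moler matrix factors as \<open>L L\<^sup>T\<close> with \<open>L\<close> unit lower triangular and all entries below the
  diagonal equal to \<open>-1\<close>, so its quadratic form is the sum of the squares of
  \<open>v\<^sub>k - (v\<^sub>k\<^sub>+\<^sub>1 + \<dots> + v\<^sub>n)\<close>. Everything else comes from the Rayleigh quotient, whose minimum is the
  smallest eigenvalue: padding a vector with zeros gives monotonicity, and a geometric test vector
  gives exponential decay. That the infimum \<open>\<mu>\<close> of the Rayleigh quotient is an eigenvalue is shown
  without compactness: a nonnegative form \<open>A - \<mu> I\<close> with nonsingular matrix would be bounded below
  by a positive multiple of \<open>v \<bullet> v\<close>, so \<open>\<mu>\<close> could be increased.\<close>

section \<open>Euclidean norm estimates for real vectors and matrices\<close>

lemma scalar_prod_self_eq: "v \<bullet> v = (\<Sum>i<dim_vec v. (v $ i)\<^sup>2)" for v :: "real vec"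
  by (simp add: scalar_prod_def power2_eq_square atLeast0LessThan)

lemma scalar_prod_self_nonneg: "v \<bullet> v \<ge> 0" for v :: "real vec"
  by (simp add: scalar_prod_self_eq sum_nonneg)

lemma scalar_prod_self_pos:
  fixes v :: "real vec"
  assumes "v \<in> carrier_vec n" "v \<noteq> 0\<^sub>v n"
  shows "v \<bullet> v > 0"
proof -
  obtain i where i: "i < n" "v $ i \<noteq> 0"
    using assms by (metis carrier_vecD eq_vecI index_zero_vec)
  have "(\<Sum>i<n. (v $ i)\<^sup>2) > 0"
    by (rule sum_pos2[of _ i]) (use i in auto)
  then show ?thesis using assms(1) by (simp add: scalar_prod_self_eq)
qed

lemma scalar_prod_Cauchy_Schwarz:
  fixes v w :: "real vec"
  assumes "dim_vec v = dim_vec w"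
  shows "(v \<bullet> w)\<^sup>2 \<le> (v \<bullet> v) * (w \<bullet> w)"
proof -
  let ?I = "{..<dim_vec w}"
  have "\<bar>v \<bullet> w\<bar> \<le> (\<Sum>i\<in>?I. \<bar>v $ i\<bar> * \<bar>w $ i\<bar>)"
    by (simp add: scalar_prod_def atLeast0LessThan flip: abs_mult)
  also have "\<dots> \<le> L2_set (\<lambda>i. v $ i) ?I * L2_set (\<lambda>i. w $ i) ?I" by (rule L2_set_mult_ineq)
  also have "\<dots> = sqrt ((v \<bullet> v) * (w \<bullet> w))"
    by (simp add: L2_set_def scalar_prod_self_eq assms real_sqrt_mult)
  finally show ?thesis by (rule sqrt_ge_absD)
qed

text \<open>Each coordinate of \<open>A *\<^sub>v v\<close> is a row times \<open>v\<close>, so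
  Cauchy-Schwarz row by row bounds the squared norm by the squared Frobenius norm of
  \<open>A\<close> times \<open>v \<bullet> v\<close>.\<close>

lemma mult_mat_vec_bounded:
  fixes A :: "real mat"
  assumes A: "A \<in> carrier_mat m n"
  obtains C where "C > 0" "\<And>v. v \<in> carrier_vec n \<Longrightarrow> (A *\<^sub>v v) \<bullet> (A *\<^sub>v v) \<le> C * (v \<bullet> v)"
proof
  let ?C = "\<Sum>i<m. row A i \<bullet> row A i"
  have C: "?C \<ge> 0" by (intro sum_nonneg scalar_prod_self_nonneg)
  \<comment> \<open>Adding 1 keeps the constant positive even when all rows vanish.\<close>
  then show "?C + 1 > 0" by simp
  fix v :: "real vec" assume v: "v \<in> carrier_vec n"
  have "(A *\<^sub>v v) \<bullet> (A *\<^sub>v v) = (\<Sum>i<m. (row A i \<bullet> v)\<^sup>2)"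
    using A by (simp add: scalar_prod_self_eq)
  also have "\<dots> \<le> (\<Sum>i<m. (row A i \<bullet> row A i) * (v \<bullet> v))"
    by (intro sum_mono scalar_prod_Cauchy_Schwarz) (use A v in auto)
  also have "\<dots> \<le> (?C + 1) * (v \<bullet> v)"
    using scalar_prod_self_nonneg[of v] by (simp add: sum_distrib_right distrib_right)
  finally show "(A *\<^sub>v v) \<bullet> (A *\<^sub>v v) \<le> (?C + 1) * (v \<bullet> v)" .
qed

text \<open>Cauchy-Schwarz for \<open>v\<close> and \<open>A *\<^sub>v v\<close> reduces this to the
  bound on the squared norm of \<open>A *\<^sub>v v\<close>; hence the square root of its
  constant.\<close>

lemma quadratic_form_bounded:
  fixes A :: "real mat"
  assumes A: "A \<in> carrier_mat n n"
  obtains C where "C > 0" "\<And>v. v \<in> carrier_vec n \<Longrightarrow> \<bar>v \<bullet> (A *\<^sub>v v)\<bar> \<le> C * (v \<bullet> v)"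
proof -
  obtain C where C: "C > 0"
    "\<And>v. v \<in> carrier_vec n \<Longrightarrow> (A *\<^sub>v v) \<bullet> (A *\<^sub>v v) \<le> C * (v \<bullet> v)"
    using mult_mat_vec_bounded[OF A] by blast
  show ?thesis
  proof
    show "sqrt C > 0" using C by simp
    fix v :: "real vec" assume v: "v \<in> carrier_vec n"
    have "(v \<bullet> (A *\<^sub>v v))\<^sup>2 \<le> (v \<bullet> v) * ((A *\<^sub>v v) \<bullet> (A *\<^sub>v v))"
      by (rule scalar_prod_Cauchy_Schwarz) (use A v in auto)
    also have "\<dots> \<le> (v \<bullet> v) * (C * (v \<bullet> v))"
      by (intro mult_left_mono C v scalar_prod_self_nonneg)
    also have "\<dots> = (sqrt C * (v \<bullet> v))\<^sup>2"
      using C(1) by (simp add: power_mult_distrib) (simp add: power2_eq_square)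
    finally show "\<bar>v \<bullet> (A *\<^sub>v v)\<bar> \<le> sqrt C * (v \<bullet> v)"
      by (rule abs_le_square_iff[THEN iffD2, THEN order_trans])
         (use C(1) scalar_prod_self_nonneg[of v] in simp)
  qed
qed

section \<open>Rayleigh quotient and least eigenvalue of a symmetric matrix\<close>

lemma symmetric_mat_scalar_prod_commute:
  fixes A :: "real mat"
  assumes A: "A \<in> carrier_mat n n" and sym: "transpose_mat A = A"
    and v: "v \<in> carrier_vec n" and w: "w \<in> carrier_vec n"
  shows "v \<bullet> (A *\<^sub>v w) = w \<bullet> (A *\<^sub>v v)"
proof -
  have "v \<bullet> (A *\<^sub>v w) = (A *\<^sub>v w) \<bullet> v"
    by (rule comm_scalar_prod[of _ n]) (use A v w in auto)
  also have "\<dots> = (transpose_mat A *\<^sub>v w) \<bullet> v" by (simp only: sym)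
  also have "\<dots> = w \<bullet> (A *\<^sub>v v)" by (rule transpose_vec_mult_scalar[OF A v w])
  finally show ?thesis .
qed

text \<open>With \<open>w = B *\<^sub>v v\<close>, nonnegativity of the form at
  \<open>v - (1 / C) \<cdot>\<^sub>v w\<close> forces
  \<open>(w \<bullet> w) / C \<le> v \<bullet> w\<close>, and boundedness of the inverse gives
  \<open>v \<bullet> v \<le> D * (w \<bullet> w)\<close>. Together they yield the constant
  \<open>1 / (C * D)\<close>.\<close>

lemma nonneg_symmetric_mat_invertible_coercive:
  fixes B :: "real mat"
  assumes B: "B \<in> carrier_mat n n" and sym: "transpose_mat B = B"
    and nonneg: "\<And>v. v \<in> carrier_vec n \<Longrightarrow> v \<bullet> (B *\<^sub>v v) \<ge> 0"
    and det: "det B \<noteq> 0"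
  obtains c where "c > 0" "\<And>v. v \<in> carrier_vec n \<Longrightarrow> c * (v \<bullet> v) \<le> v \<bullet> (B *\<^sub>v v)"
proof -
  \<comment> \<open>The argument \<open>()\<close> fills the record extension slot of the matrix
    ring whose units are considered.\<close>
  obtain B' where B': "B' \<in> carrier_mat n n" "B' * B = 1\<^sub>m n"
    using det_non_zero_imp_unit[OF B det, of "()"]
    by (auto simp: Units_def ring_mat_def)
  obtain C where C: "C > 0" "\<And>v. v \<in> carrier_vec n \<Longrightarrow> \<bar>v \<bullet> (B *\<^sub>v v)\<bar> \<le> C * (v \<bullet> v)"
    using quadratic_form_bounded[OF B] by blast
  obtain D where D: "D > 0" "\<And>v. v \<in> carrier_vec n \<Longrightarrow> (B' *\<^sub>v v) \<bullet> (B' *\<^sub>v v) \<le> D * (v \<bullet> v)"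
    using mult_mat_vec_bounded[OF B'(1)] by blast
  show ?thesis
  proof
    show "1 / (C * D) > 0" using C D by simp
    fix v :: "real vec" assume v: "v \<in> carrier_vec n"
    define w where "w = B *\<^sub>v v"
    have w: "w \<in> carrier_vec n" using B v by (simp add: w_def)
    have Bw: "B *\<^sub>v w \<in> carrier_vec n" using B w by simp
    have "v = B' *\<^sub>v w"
      using assoc_mult_mat_vec[OF B'(1) B v] B'(2) v by (simp add: w_def)
    then have 1: "v \<bullet> v \<le> D * (w \<bullet> w)" using D(2)[OF w] by simp
    \<comment> \<open>the step of steepest descent for the form, from \<open>v\<close> against its gradient \<open>B v\<close>\<close>
    define t where "t = 1 / C"
    define u where "u = v - t \<cdot>\<^sub>v w"
    have u: "u \<in> carrier_vec n" using v w by (simp add: u_def)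
    have "B *\<^sub>v u = w - t \<cdot>\<^sub>v (B *\<^sub>v w)"
      unfolding u_def using B v w by (simp add: mult_minus_distrib_mat_vec mult_mat_vec w_def)
    then have "u \<bullet> (B *\<^sub>v u) = v \<bullet> w - t * (v \<bullet> (B *\<^sub>v w)) - t * (w \<bullet> w - t * (w \<bullet> (B *\<^sub>v w)))"
      unfolding u_def using v w Bw
      by (simp add: minus_scalar_prod_distrib[of _ n] scalar_prod_minus_distrib[of _ n] algebra_simps)
    also have "v \<bullet> (B *\<^sub>v w) = w \<bullet> w"
      using symmetric_mat_scalar_prod_commute[OF B sym v w] by (simp add: w_def)
    finally have "0 \<le> v \<bullet> w - 2 * t * (w \<bullet> w) + t\<^sup>2 * (w \<bullet> (B *\<^sub>v w))"
      using nonneg[OF u] by (simp add: power2_eq_square algebra_simps)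
    also have "\<dots> \<le> v \<bullet> w - 2 * t * (w \<bullet> w) + t\<^sup>2 * (C * (w \<bullet> w))"
      using C(2)[OF w] by (intro add_left_mono mult_left_mono) auto
    \<comment> \<open>The value \<open>t = 1 / C\<close> minimises
      \<open>- 2 * t + C * t\<^sup>2\<close>, with minimum \<open>- 1 / C\<close>.\<close>
    also have "\<dots> = v \<bullet> w - (w \<bullet> w) / C"
      using C(1) by (simp add: t_def power2_eq_square field_simps)
    finally have "(w \<bullet> w) / C \<le> v \<bullet> w" by simp
    moreover have "1 / (C * D) * (v \<bullet> v) \<le> (w \<bullet> w) / C"
      using 1 C(1) D(1) by (simp add: field_simps)
    ultimately show "1 / (C * D) * (v \<bullet> v) \<le> v \<bullet> (B *\<^sub>v v)"
      by (simp add: w_def)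
  qed
qed

lemma symmetric_mat_least_eigenvalue:
  fixes A :: "real mat"
  assumes A: "A \<in> carrier_mat n n" and n: "n > 0" and sym: "transpose_mat A = A"
  obtains \<mu> where "eigenvalue A \<mu>" "\<And>v. v \<in> carrier_vec n \<Longrightarrow> \<mu> * (v \<bullet> v) \<le> v \<bullet> (A *\<^sub>v v)"
proof -
  define S where "S = {(v \<bullet> (A *\<^sub>v v)) / (v \<bullet> v) |v. v \<in> carrier_vec n \<and> v \<noteq> 0\<^sub>v n}"
  define \<mu> where "\<mu> = Inf S"
  define B where "B = A - \<mu> \<cdot>\<^sub>m 1\<^sub>m n"
  obtain C where C: "C > 0" "\<And>v. v \<in> carrier_vec n \<Longrightarrow> \<bar>v \<bullet> (A *\<^sub>v v)\<bar> \<le> C * (v \<bullet> v)"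
    using quadratic_form_bounded[OF A] by blast
  \<comment> \<open>A real \<open>Inf\<close> is informative only for a nonempty set that is bounded
    below: the bound on the form gives the latter, and \<open>n > 0\<close> supplies a nonzero
    vector.\<close>
  have "- C \<le> x" if "x \<in> S" for x
  proof -
    obtain v where v: "v \<in> carrier_vec n" "v \<noteq> 0\<^sub>v n" "x = (v \<bullet> (A *\<^sub>v v)) / (v \<bullet> v)"
      using \<open>x \<in> S\<close> by (auto simp: S_def)
    have "- C * (v \<bullet> v) \<le> v \<bullet> (A *\<^sub>v v)" using C(2)[OF v(1)] by simp
    then show ?thesis
      unfolding v(3) by (rule pos_le_divide_eq[THEN iffD2, OF scalar_prod_self_pos[OF v(1,2)]])
  qed
  then have bdd: "bdd_below S" by (rule bdd_belowI)
  have "unit_vec n 0 \<noteq> (0\<^sub>v n :: real vec)"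
    using n by (metis index_unit_vec(2) index_zero_vec(1) zero_neq_one)
  then have ne: "S \<noteq> {}" unfolding S_def using unit_vec_carrier by blast
  have Rayleigh: "\<mu> * (v \<bullet> v) \<le> v \<bullet> (A *\<^sub>v v)" if v: "v \<in> carrier_vec n" for v
  proof (cases "v = 0\<^sub>v n")
    case True
    then show ?thesis using A by simp
  next
    case False
    then have "\<mu> \<le> (v \<bullet> (A *\<^sub>v v)) / (v \<bullet> v)"
      unfolding \<mu>_def by (intro cInf_lower bdd) (use v in \<open>auto simp: S_def\<close>)
    then show ?thesis using scalar_prod_self_pos[OF v False] by (simp add: field_simps)
  qed
  have B: "B \<in> carrier_mat n n" by (simp add: B_def minus_carrier_mat)
  have Bv: "B *\<^sub>v v = A *\<^sub>v v - \<mu> \<cdot>\<^sub>v v" if "v \<in> carrier_vec n" for v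
  proof -
    have "(\<mu> \<cdot>\<^sub>m 1\<^sub>m n) *\<^sub>v v = \<mu> \<cdot>\<^sub>v v" using that by (intro eq_vecI) auto
    then show ?thesis using A that by (simp add: B_def minus_mult_distrib_mat_vec)
  qed
  have form: "v \<bullet> (B *\<^sub>v v) = v \<bullet> (A *\<^sub>v v) - \<mu> * (v \<bullet> v)" if "v \<in> carrier_vec n" for v
    using A that by (simp add: Bv scalar_prod_minus_distrib[of _ n])
  have symB: "transpose_mat B = B"
  proof -
    have "A $$ (j, i) = A $$ (i, j)" if "i < n" "j < n" for i j
      using that A sym by (metis carrier_matD index_transpose_mat(1))
    then show ?thesis using A by (intro eq_matI) (auto simp: B_def)
  qed
  have nonneg: "v \<bullet> (B *\<^sub>v v) \<ge> 0" if "v \<in> carrier_vec n" for v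
    using Rayleigh[OF that] form[OF that] by simp
  have "det B = 0"
  proof (rule ccontr)
    assume det: "det B \<noteq> 0"
    obtain c where c: "c > 0" "\<And>v. v \<in> carrier_vec n \<Longrightarrow> c * (v \<bullet> v) \<le> v \<bullet> (B *\<^sub>v v)"
      using nonneg_symmetric_mat_invertible_coercive[OF B symB nonneg det] by blast
    have "\<mu> + c \<le> x" if "x \<in> S" for x
    proof -
      obtain v where v: "v \<in> carrier_vec n" "v \<noteq> 0\<^sub>v n" "x = (v \<bullet> (A *\<^sub>v v)) / (v \<bullet> v)"
        using \<open>x \<in> S\<close> by (auto simp: S_def)
      have "(\<mu> + c) * (v \<bullet> v) \<le> v \<bullet> (A *\<^sub>v v)"
        using c(2)[OF v(1)] form[OF v(1)] by (simp add: algebra_simps)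
      then show ?thesis
        unfolding v(3) by (rule pos_le_divide_eq[THEN iffD2, OF scalar_prod_self_pos[OF v(1,2)]])
    qed
    then have "\<mu> + c \<le> \<mu>" unfolding \<mu>_def by (intro cInf_greatest ne)
    with c(1) show False by simp
  qed
  then obtain v where v: "v \<in> carrier_vec n" "v \<noteq> 0\<^sub>v n" "B *\<^sub>v v = 0\<^sub>v n"
    using det_0_iff_vec_prod_zero[OF B] by blast
  have "A *\<^sub>v v = \<mu> \<cdot>\<^sub>v v"
  proof (rule eq_vecI)
    fix i assume "i < dim_vec (\<mu> \<cdot>\<^sub>v v)"
    then have i: "i < n" using v by simp
    have "(A *\<^sub>v v - \<mu> \<cdot>\<^sub>v v) $ i = 0" using v(3) Bv[OF v(1)] i by simp
    then show "(A *\<^sub>v v) $ i = (\<mu> \<cdot>\<^sub>v v) $ i" using i v(1) A by simp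
  qed (use A v in simp)
  then have "eigenvalue A \<mu>"
    using v A by (auto simp: eigenvalue_def eigenvector_def)
  then show ?thesis using Rayleigh that by blast
qed

text \<open>As \<mu> lies in the finite spectrum, \<open>Min\<close> is attained there and is at
  most \<mu>; the Rayleigh bound for \<mu> passes to every smaller number because
  \<open>v \<bullet> v\<close> is nonnegative.\<close>

lemma
  fixes A :: "real mat"
  assumes A: "A \<in> carrier_mat n n" and n: "n > 0" and sym: "transpose_mat A = A"
  shows eigenvalue_lambda_min: "eigenvalue A (lambda_min A)"
    and lambda_min_Rayleigh:
      "v \<in> carrier_vec n \<Longrightarrow> lambda_min A * (v \<bullet> v) \<le> v \<bullet> (A *\<^sub>v v)"
proof -
  obtain \<mu> where \<mu>: "eigenvalue A \<mu>"
    "\<And>v. v \<in> carrier_vec n \<Longrightarrow> \<mu> * (v \<bullet> v) \<le> v \<bullet> (A *\<^sub>v v)"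
    using symmetric_mat_least_eigenvalue[OF A n sym] by blast
  have fin: "finite (spectrum A)" by (rule card_finite_spectrum[OF A])
  have mem: "\<mu> \<in> spectrum A" using \<mu>(1) by (simp add: spectrum_def)
  have "lambda_min A \<in> spectrum A" unfolding lambda_min_def using fin mem by (intro Min_in) auto
  then show "eigenvalue A (lambda_min A)" by (simp add: spectrum_def)
  assume v: "v \<in> carrier_vec n"
  have "lambda_min A \<le> \<mu>" unfolding lambda_min_def using fin mem by simp
  then have "lambda_min A * (v \<bullet> v) \<le> \<mu> * (v \<bullet> v)"
    by (intro mult_right_mono scalar_prod_self_nonneg)
  with \<mu>(2)[OF v] show "lambda_min A * (v \<bullet> v) \<le> v \<bullet> (A *\<^sub>v v)" by simp
qed

lemma lambda_min_eigenvector: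
  fixes A :: "real mat"
  assumes A: "A \<in> carrier_mat n n" and n: "n > 0" and sym: "transpose_mat A = A"
  obtains v where "v \<in> carrier_vec n" "v \<noteq> 0\<^sub>v n" "v \<bullet> (A *\<^sub>v v) = lambda_min A * (v \<bullet> v)"
  using eigenvalue_lambda_min[OF A n sym] A that
  by (auto simp: eigenvalue_def eigenvector_def)

section \<open>Cholesky factorization of the Moler matrix and its quadratic form\<close>

definition moler_factor :: "nat \<Rightarrow> real mat" where
  "moler_factor n = mat n n (\<lambda>(i, j). if i = j then 1 else if j < i then -1 else 0)"

lemma moler_factor_carrier [simp]: "moler_factor n \<in> carrier_mat n n"
  by (simp add: moler_factor_def)

lemma moler_mat_carrier [simp]: "moler_mat n \<in> carrier_mat n n"
  by (simp add: moler_mat_def)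

lemma transpose_moler_mat [simp]: "transpose_mat (moler_mat n) = moler_mat n"
  by (auto simp: moler_mat_def min.commute)

text \<open>In the product of rows \<open>i\<close> and \<open>j\<close> of the factor, each column
  before \<open>min i j\<close> contributes \<open>(-1) * (-1) = 1\<close>, the column
  \<open>min i j\<close> contributes 1 on the diagonal and -1 off it, and later columns contribute
  0.\<close>

lemma moler_mat_factorization:
  "moler_mat n = moler_factor n * transpose_mat (moler_factor n)"
proof (rule eq_matI)
  fix i j
  assume "i < dim_row (moler_factor n * transpose_mat (moler_factor n))"
    "j < dim_col (moler_factor n * transpose_mat (moler_factor n))"
  then have ij: "i < n" "j < n" by (auto simp: moler_factor_def)
  let ?m = "min i j"
  have m: "?m < n" using ij by simp
  have "(moler_factor n * transpose_mat (moler_factor n)) $$ (i, j) =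
      (\<Sum>k<n. moler_factor n $$ (i, k) * moler_factor n $$ (j, k))"
    using ij by (simp add: moler_factor_def scalar_prod_def atLeast0LessThan)
  also have "\<dots> = (\<Sum>k<n. (if k < ?m then 1 else 0) + (if k = ?m then if i = j then 1 else -1 else 0))"
    using ij by (intro sum.cong) (auto simp: moler_factor_def)
  also have "\<dots> = real ?m + (if i = j then 1 else -1)"
  proof -
    have "{..<n} \<inter> {k. k < ?m} = {..<?m}" using m by auto
    then show ?thesis using m by (simp add: sum.distrib sum.If_cases)
  qed
  \<comment> \<open>With indices from 0, \<open>?m + 1\<close> is the diagonal entry
    \<open>i + 1\<close>, and \<open>?m - 1\<close> is
    \<open>min (i + 1) (j + 1) - 2\<close>.\<close>
  also have "\<dots> = moler_mat n $$ (i, j)" using ij by (auto simp: moler_mat_def min_def)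
  finally show "moler_mat n $$ (i, j) = (moler_factor n * transpose_mat (moler_factor n)) $$ (i, j)" ..
qed (auto simp: moler_mat_def moler_factor_def)

text \<open>Moving the left factor across the scalar product leaves the squared norm of the
  transposed factor applied to \<open>v\<close>; its coordinate \<open>k\<close> reads column
  \<open>k\<close> of the factor, which is 1 on the diagonal and -1 below.\<close>

lemma moler_quadratic_form:
  assumes v: "v \<in> carrier_vec n"
  shows "v \<bullet> (moler_mat n *\<^sub>v v) = (\<Sum>k<n. (v $ k - (\<Sum>i\<in>{k<..<n}. v $ i))\<^sup>2)"
proof -
  let ?L = "moler_factor n"
  have Lv: "transpose_mat ?L *\<^sub>v v \<in> carrier_vec n"
    by (rule mult_mat_vec_carrier[of _ n n]) (use v in auto)
  have entry: "(transpose_mat ?L *\<^sub>v v) $ k = v $ k - (\<Sum>i\<in>{k<..<n}. v $ i)" if k: "k < n" for k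
  proof -
    have "(transpose_mat ?L *\<^sub>v v) $ k = (\<Sum>i<n. ?L $$ (i, k) * v $ i)"
      using k v by (simp add: moler_factor_def scalar_prod_def atLeast0LessThan)
    also have "\<dots> = (\<Sum>i<n. (if i = k then v $ i else 0) - (if k < i then v $ i else 0))"
      using k by (intro sum.cong) (auto simp: moler_factor_def)
    also have "\<dots> = v $ k - (\<Sum>i\<in>{k<..<n}. v $ i)"
    proof -
      have "{..<n} \<inter> {i. k < i} = {k<..<n}" by auto
      then show ?thesis using k by (simp add: sum_subtractf sum.If_cases)
    qed
    finally show ?thesis .
  qed
  have "v \<bullet> (moler_mat n *\<^sub>v v) = v \<bullet> (?L *\<^sub>v (transpose_mat ?L *\<^sub>v v))"
    using v by (simp add: moler_mat_factorization assoc_mult_mat_vec[of _ n n _ n])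
  also have "\<dots> = (transpose_mat ?L *\<^sub>v v) \<bullet> (transpose_mat ?L *\<^sub>v v)"
    by (rule transpose_vec_mult_scalar[symmetric, OF moler_factor_carrier Lv v])
  also have "\<dots> = (\<Sum>k<n. (v $ k - (\<Sum>i\<in>{k<..<n}. v $ i))\<^sup>2)"
    unfolding scalar_prod_self_eq carrier_vecD[OF Lv] by (intro sum.cong refl) (simp add: entry)
  finally show ?thesis .
qed

section \<open>Positive definiteness and monotonicity in the dimension\<close>

lemma positive_definite_moler_mat: "positive_definite (moler_mat n)"
  unfolding positive_definite_def
proof (intro conjI ballI impI)
  show "square_mat (moler_mat n)" by (simp add: moler_mat_def)
  show "transpose_mat (moler_mat n) = moler_mat n" by simp
  fix v :: "real vec"
  assume "v \<in> carrier_vec (dim_row (moler_mat n))" "v \<noteq> 0\<^sub>v (dim_row (moler_mat n))"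
  then have v: "v \<in> carrier_vec n" "v \<noteq> 0\<^sub>v n" by (auto simp: moler_mat_def)
  \<comment> \<open>the last nonzero coordinate contributes its own square\<close>
  define P where "P i \<longleftrightarrow> i < n \<and> v $ i \<noteq> 0" for i
  define k where "k = (GREATEST i. P i)"
  have "\<exists>i. P i" unfolding P_def using v by (metis carrier_vecD eq_vecI index_zero_vec)
  then have k: "P k" unfolding k_def by (rule GreatestI_ex_nat[of _ n]) (auto simp: P_def)
  have "v $ i = 0" if "k < i" "i < n" for i
  proof (rule ccontr)
    assume "v $ i \<noteq> 0"
    then have "i \<le> k"
      unfolding k_def using that by (intro Greatest_le_nat[of P i n]) (auto simp: P_def)
    with \<open>k < i\<close> show False by simp
  qed
  then have "(\<Sum>i\<in>{k<..<n}. v $ i) = 0" by (intro sum.neutral) auto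
  then have "(\<Sum>k<n. (v $ k - (\<Sum>i\<in>{k<..<n}. v $ i))\<^sup>2) > 0"
    using k by (intro sum_pos2[of _ k]) (auto simp: P_def)
  then show "v \<bullet> (moler_mat n *\<^sub>v v) > 0" using moler_quadratic_form[OF v(1)] by simp
qed

text \<open>An eigenvector for the least eigenvalue inherits its sign from the form. This is the
  lower bound in the limit argument.\<close>

lemma lambda_min_moler_mat_pos:
  assumes "n > 0"
  shows "lambda_min (moler_mat n) > 0"
proof -
  obtain v where v: "v \<in> carrier_vec n" "v \<noteq> 0\<^sub>v n"
    "v \<bullet> (moler_mat n *\<^sub>v v) = lambda_min (moler_mat n) * (v \<bullet> v)"
    using lambda_min_eigenvector[OF moler_mat_carrier assms transpose_moler_mat] by blast
  have "v \<bullet> (moler_mat n *\<^sub>v v) > 0"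
    using positive_definite_moler_mat[of n] v by (auto simp: positive_definite_def moler_mat_def)
  then show ?thesis
    using v(3) scalar_prod_self_pos[OF v(1,2)] by (simp add: zero_less_mult_iff)
qed

text \<open>Padding a minimising eigenvector with zeros changes neither its norm nor the value of
  the form, so the Rayleigh quotient in dimension \<open>n\<close> already reaches the least
  eigenvalue of dimension \<open>m\<close>.\<close>

lemma lambda_min_moler_mat_antimono:
  assumes "0 < m" "m \<le> n"
  shows "lambda_min (moler_mat n) \<le> lambda_min (moler_mat m)"
proof -
  obtain v where v: "v \<in> carrier_vec m" "v \<noteq> 0\<^sub>v m"
    "v \<bullet> (moler_mat m *\<^sub>v v) = lambda_min (moler_mat m) * (v \<bullet> v)"
    using lambda_min_eigenvector[OF moler_mat_carrier assms(1) transpose_moler_mat] by blast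
  define w where "w = vec n (\<lambda>i. if i < m then v $ i else 0)"
  have w: "w \<in> carrier_vec n" by (simp add: w_def)
  have restrict: "(\<Sum>k<n. f k) = (\<Sum>k<m. f k)"
    if "\<And>k. m \<le> k \<Longrightarrow> k < n \<Longrightarrow> f k = 0" for f :: "nat \<Rightarrow> real"
    by (rule sum.mono_neutral_right) (use assms(2) that in auto)
  have tail: "(\<Sum>i\<in>{k<..<n}. w $ i) = (\<Sum>i\<in>{k<..<m}. v $ i)" for k
  proof -
    have "(\<Sum>i\<in>{k<..<n}. w $ i) = (\<Sum>i\<in>{k<..<m}. w $ i)"
      by (rule sum.mono_neutral_right) (use assms(2) in \<open>auto simp: w_def\<close>)
    also have "\<dots> = (\<Sum>i\<in>{k<..<m}. v $ i)" using assms(2) by (intro sum.cong) (auto simp: w_def)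
    finally show ?thesis .
  qed
  have "w \<bullet> w = (\<Sum>k<n. (w $ k)\<^sup>2)" using w by (simp add: scalar_prod_self_eq)
  also have "\<dots> = (\<Sum>k<m. (w $ k)\<^sup>2)" by (rule restrict) (simp add: w_def)
  also have "\<dots> = v \<bullet> v" using v assms(2) by (simp add: scalar_prod_self_eq w_def)
  finally have norm: "w \<bullet> w = v \<bullet> v" .
  have "w \<bullet> (moler_mat n *\<^sub>v w) = (\<Sum>k<n. (w $ k - (\<Sum>i\<in>{k<..<m}. v $ i))\<^sup>2)"
    by (simp add: moler_quadratic_form[OF w] tail)
  \<comment> \<open>For \<open>k \<ge> m\<close> the coordinate is padding and the range
    \<open>{k<..<m}\<close> is empty, so the square vanishes.\<close>
  also have "\<dots> = (\<Sum>k<m. (w $ k - (\<Sum>i\<in>{k<..<m}. v $ i))\<^sup>2)"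
    by (rule restrict) (simp add: w_def)
  also have "\<dots> = v \<bullet> (moler_mat m *\<^sub>v v)"
    using assms(2) by (simp add: moler_quadratic_form[OF v(1)] w_def)
  finally have "w \<bullet> (moler_mat n *\<^sub>v w) = v \<bullet> (moler_mat m *\<^sub>v v)" .
  then have "lambda_min (moler_mat n) * (v \<bullet> v) \<le> lambda_min (moler_mat m) * (v \<bullet> v)"
    using lambda_min_Rayleigh[OF moler_mat_carrier _ transpose_moler_mat w] assms v(3) norm by simp
  then show ?thesis using scalar_prod_self_pos[OF v(1,2)] by simp
qed

section \<open>Exponential decay of the least eigenvalue\<close>

lemma sum_half_powers:
  assumes "k < n"
  shows "(\<Sum>i\<in>{k<..<n}. (1/2::real) ^ i) = (1/2) ^ k - (1/2) ^ (n - 1)"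
proof -
  have "{k<..<n} = {Suc k..<n}" by auto
  moreover have "(\<Sum>i\<in>{Suc k..<n}. (1/2::real) ^ i) = (1/2) ^ k - (1/2) ^ (n - 1)"
    using assms[THEN Suc_leI]
  proof (induction n rule: dec_induct)
    case (step n)
    \<comment> \<open>Here \<open>n \<ge> Suc k\<close>, so the subtraction in \<open>n - 1\<close>
      is not truncated.\<close>
    then obtain l where "n = Suc l" by (cases n) auto
    with step show ?case by simp
  qed simp
  ultimately show ?thesis by simp
qed

text \<open>The test vector \<open>(1, 1/2, 1/4, \<dots>)\<close> makes all squares in the quadratic form
  equal and exponentially small.\<close>

lemma lambda_min_moler_mat_le:
  assumes "n > 0"
  shows "lambda_min (moler_mat n) \<le> real n * ((1/2) ^ (n - 1))\<^sup>2"
proof -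
  define v :: "real vec" where "v = vec n (\<lambda>i. (1/2) ^ i)"
  have v: "v \<in> carrier_vec n" by (simp add: v_def)
  have "v $ k - (\<Sum>i\<in>{k<..<n}. v $ i) = (1/2) ^ (n - 1)" if "k < n" for k
    using sum_half_powers[OF that] that by (simp add: v_def)
  then have form: "v \<bullet> (moler_mat n *\<^sub>v v) = real n * ((1/2) ^ (n - 1))\<^sup>2"
    by (simp add: moler_quadratic_form[OF v])
  \<comment> \<open>The first coordinate is 1 and alone gives \<open>v \<bullet> v \<ge> 1\<close>;
    as the least eigenvalue is positive, it is then at most its product with
    \<open>v \<bullet> v\<close>.\<close>
  have "(v $ 0)\<^sup>2 \<le> (\<Sum>i<n. (v $ i)\<^sup>2)"
    by (rule member_le_sum) (use assms in auto)
  then have "1 \<le> v \<bullet> v" using assms by (simp add: scalar_prod_self_eq v_def)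
  then have "lambda_min (moler_mat n) * 1 \<le> lambda_min (moler_mat n) * (v \<bullet> v)"
    using lambda_min_moler_mat_pos[OF assms] by (intro mult_left_mono) auto
  also have "\<dots> \<le> v \<bullet> (moler_mat n *\<^sub>v v)"
    by (rule lambda_min_Rayleigh[OF moler_mat_carrier assms transpose_moler_mat v])
  finally show ?thesis by (simp add: form)
qed

theorem proposition1:
  shows "(\<forall>n\<ge>1. positive_definite (moler_mat n)) \<and>
    (\<forall>m n. 1 \<le> m \<and> m \<le> n \<longrightarrow> lambda_min (moler_mat n) \<le> lambda_min (moler_mat m)) \<and>
    (\<lambda>n. lambda_min (moler_mat n)) \<longlonglongrightarrow> 0"
proof (intro conjI allI impI)
  show "positive_definite (moler_mat n)" for n by (rule positive_definite_moler_mat)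
  show "lambda_min (moler_mat n) \<le> lambda_min (moler_mat m)" if "1 \<le> m \<and> m \<le> n" for m n
    using that by (intro lambda_min_moler_mat_antimono) auto
  show "(\<lambda>n. lambda_min (moler_mat n)) \<longlonglongrightarrow> 0"
  proof (rule real_tendsto_sandwich)
    \<comment> \<open>Both bounds hold only eventually: for \<open>n = 0\<close> the spectrum is
      empty and its \<open>Min\<close> is unspecified.\<close>
    show "\<forall>\<^sub>F n in sequentially. 0 \<le> lambda_min (moler_mat n)"
      using eventually_gt_at_top[of 0]
      by eventually_elim (use lambda_min_moler_mat_pos in \<open>simp add: less_imp_le\<close>)
    show "\<forall>\<^sub>F n in sequentially. lambda_min (moler_mat n) \<le> real n * ((1/2) ^ (n - 1))\<^sup>2"
      using eventually_gt_at_top[of 0] by eventually_elim (rule lambda_min_moler_mat_le)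
    show "(\<lambda>n. real n * ((1/2) ^ (n - 1))\<^sup>2) \<longlonglongrightarrow> 0" by real_asymp
  qed simp
qed

end
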